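(* Let $X$ and $Y$ be sets, let $r\colon X\times Y\to[0,1]$ be a fuzzy relation, and let $\mu\in\mathcal{D}X$, $\nu\in\mathcal{D}Y$. Then \[ \kappa_\lambda(r)(\mu,\nu)=W_\lambda(r)(\mu,\nu), \] i.e. the relational Lévy–Prokhorov lifting $d_{LP}(r):=W_\lambda(r)$ coincides with the relational Kantorovich lifting $\kappa_\lambda(r)$ at $(\mu,\nu)$.
   Context: For a set $Z$, $\mathcal{D}Z$ is the set of finitely supported probability distributions $\mu\colon Z\to[0,1]$; for $f\colon Z\to[0,1]$, $\mathbb{E}_\mu[f]=\sum_z\mu(z)f(z)$, and $\mu(S)=\sum_{z\in S}\mu(z)$. The "generally" predicate lifting is $\lambda_Z(f)(\mu)=\inf\{\epsilon\ge 0\mid \mu(\{z\in Z\mid f(z)>\epsilon\})\le\epsilon\}$ for $f\colon Z\to[0,1]$, $\mu\in\mathcal{D}Z$. A coupling of $\mu\in\mathcal{D}X$ and $\nu\in\mathcal{D}Y$ is $\rho\in\mathcal{D}(X\times Y)$ whose marginals are $\mu$ and $\nu$; $\Gamma(\mu,\nu)$ is the set of couplings. The relational Wasserstein lifting is $W_\lambda(r)(\mu,\nu)=\inf\{\lambda_{X\times Y}(r)(\rho)\mid\rho\in\Gamma(\mu,\nu)\}$. A pair $(f,g)$ with $f\colon X\to[0,1]$, $g\colon Y\to[0,1]$ is $r$-nonexpansive if $g(y)-f(x)\le r(x,y)$ for all $x\in X,y\in Y$. The relational Kantorovich lifting is $\kappa_\lambda(r)(\mu,\nu)=\sup\{\lambda_Y(g)(\nu)\ominus\lambda_X(f)(\mu)\mid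 (f,g)\ r\text{-nonexpansive}\}$, where $a\ominus b=\max\{0,a-b\}$. *)

theory Defs
  imports "HOL-Probability.Probability_Mass_Function"
begin

text \<open>
  The sets \<open>X\<close>, \<open>Y\<close>, \<open>Z\<close> are represented by types. Every infimum and supremum
  below is taken over a nonempty subset of the reals bounded on the relevant side (for arguments
  with values in \<open>[0,1]\<close>), so the conditionally complete operations on \<open>real\<close> agree
  with those of \<open>[0,1]\<close>.
\<close>

definition fin_dists :: "'a pmf set" where
  "fin_dists = {\<mu>. finite (set_pmf \<mu>)}"

definition generally :: "('a \<Rightarrow> real) \<Rightarrow> 'a pmf \<Rightarrow> real" where
  "generally f \<mu> = Inf {\<epsilon>. 0 \<le> \<epsilon> \<and> measure_pmf.prob \<mu> {z. f z > \<epsilon>} \<le> \<epsilon>}"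

definition couplings :: "'a pmf \<Rightarrow> 'b pmf \<Rightarrow> ('a \<times> 'b) pmf set" where
  "couplings \<mu> \<nu> = {\<rho> \<in> fin_dists. map_pmf fst \<rho> = \<mu> \<and> map_pmf snd \<rho> = \<nu>}"

definition wasserstein :: "('a \<times> 'b \<Rightarrow> real) \<Rightarrow> 'a pmf \<Rightarrow> 'b pmf \<Rightarrow> real" where
  "wasserstein r \<mu> \<nu> = Inf {generally r \<rho> | \<rho>. \<rho> \<in> couplings \<mu> \<nu>}"

definition nonexpansive_pair ::
  "('a \<times> 'b \<Rightarrow> real) \<Rightarrow> ('a \<Rightarrow> real) \<Rightarrow> ('b \<Rightarrow> real) \<Rightarrow> bool" where
  "nonexpansive_pair r f g \<longleftrightarrow>
     range f \<subseteq> {0..1} \<and> range g \<subseteq> {0..1} \<and> (\<forall>x y. g y - f x \<le> r (x, y))"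

definition trunc_diff :: "real \<Rightarrow> real \<Rightarrow> real" (infixl "\<ominus>" 65) where
  "a \<ominus> b = max 0 (a - b)"

definition kantorovich :: "('a \<times> 'b \<Rightarrow> real) \<Rightarrow> 'a pmf \<Rightarrow> 'b pmf \<Rightarrow> real" where
  "kantorovich r \<mu> \<nu> = Sup {generally g \<nu> \<ominus> generally f \<mu> | f g. nonexpansive_pair r f g}"

end

theory Submission imports Defs begin

text \<open>
  The inequality \<open>\<le>\<close> is a union bound: for a coupling \<open>\<rho>\<close> and a nonexpansive pair, \<open>g y > a + e\<close>
  forces \<open>f x > a\<close> or \<open>r (x, y) > e\<close>. For the converse, if \<open>\<epsilon>\<close> is below the Wasserstein value,
  then no coupling satisfies \<open>\<rho>(r > \<epsilon>) \<le> \<epsilon>\<close>, so by a finite version of Strassen's theorem there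
  is a set \<open>B\<close> with \<open>\<nu>(B) > \<delta> + \<epsilon>\<close>, where \<open>\<delta> = \<mu>(N)\<close> and \<open>N\<close> is the set of points \<open>x\<close> with
  \<open>r (x, y) \<le> \<epsilon>\<close> for some \<open>y \<in> B\<close>. The pair \<open>f = \<delta> + \<epsilon>\<close> on \<open>N\<close> and \<open>\<delta>\<close> elsewhere, \<open>g = \<delta> + \<epsilon>\<close> on \<open>B\<close> and \<open>0\<close>
  elsewhere, then witnesses that the Kantorovich value is at least \<open>\<epsilon>\<close>. Strassen's theorem is derived
  from Hall's marriage theorem with real weights.
\<close>

section \<open>Hall's theorem with real weights\<close>

definition nbrs :: "('a \<Rightarrow> 'b \<Rightarrow> bool) \<Rightarrow> 'a set \<Rightarrow> 'b set \<Rightarrow> 'a set" where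
  "nbrs R A B = {x \<in> A. \<exists>y\<in>B. R x y}"

text \<open>Nonnegativity is bundled in so that the residual weights of a subproblem carry
  everything the induction needs.\<close>

definition hall_condition ::
  "('a \<Rightarrow> 'b \<Rightarrow> bool) \<Rightarrow> 'a set \<Rightarrow> 'b set \<Rightarrow> ('a \<Rightarrow> real) \<Rightarrow> ('b \<Rightarrow> real) \<Rightarrow> bool" where
  "hall_condition R A T m n \<longleftrightarrow> (\<forall>x\<in>A. 0 \<le> m x) \<and> (\<forall>y\<in>T. 0 \<le> n y) \<and>
     (\<forall>B\<subseteq>T. sum n B \<le> sum m (nbrs R A B))"

text \<open>Sinks are filled exactly but sources may keep a surplus, since the Hall condition does
  not force equal totals. Vanishing outside \<open>A\<close> and \<open>T\<close> lets plans for
  disjoint subproblems simply be added.\<close>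

definition transport ::
  "('a \<Rightarrow> 'b \<Rightarrow> bool) \<Rightarrow> 'a set \<Rightarrow> 'b set \<Rightarrow> ('a \<Rightarrow> real) \<Rightarrow> ('b \<Rightarrow> real) \<Rightarrow> ('a \<Rightarrow> 'b \<Rightarrow> real) \<Rightarrow> bool" where
  "transport R A T m n p \<longleftrightarrow> (\<forall>x y. 0 \<le> p x y) \<and>
     (\<forall>x y. p x y \<noteq> 0 \<longrightarrow> x \<in> A \<and> y \<in> T \<and> R x y) \<and>
     (\<forall>x\<in>A. (\<Sum>y\<in>T. p x y) \<le> m x) \<and> (\<forall>y\<in>T. (\<Sum>x\<in>A. p x y) = n y)"

section \<open>Shrinking and gluing transport plans\<close>

lemma nbrs_subset: "nbrs R A B \<subseteq> A"
  by (auto simp: nbrs_def)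

lemma transport_drop_sink:
  assumes "finite T" "y \<in> T" "n y = 0" "transport R A (T - {y}) m n p"
  shows "transport R A T m n p"
proof -
  have z: "p x y = 0" for x using assms(4) unfolding transport_def by blast
  have "(\<Sum>y\<in>T. p x y) = (\<Sum>y\<in>T - {y}. p x y)" for x
    using assms(1,2) z[of x] by (simp add: sum.remove)
  moreover have "(\<Sum>x\<in>A. p x z) = n z" if "z \<in> T" for z
    using assms(3,4) that z unfolding transport_def by (cases "z = y") auto
  ultimately show ?thesis using assms(4) unfolding transport_def by auto
qed

lemma transport_drop_source:
  assumes "finite A" "x \<in> A" "m x = 0" "transport R (A - {x}) T m n p"
  shows "transport R A T m n p"
proof -
  have z: "p x y = 0" for y using assms(4) unfolding transport_def by blast
  have "(\<Sum>x\<in>A. p x y) = (\<Sum>x\<in>A - {x}. p x y)" for y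
    using assms(1,2) z[of y] by (simp add: sum.remove)
  moreover have "(\<Sum>y\<in>T. p w y) \<le> m w" if "w \<in> A" for w
    using assms(3,4) that z unfolding transport_def by (cases "w = x") auto
  ultimately show ?thesis using assms(4) unfolding transport_def by auto
qed

text \<open>The two plans live on disjoint blocks, so each row and each column sees only one of the
  summands.\<close>

lemma transport_union:
  assumes fin: "finite A" "finite T" and sub: "A1 \<subseteq> A" "B \<subseteq> T"
    and p1: "transport R A1 B m n p1" and p2: "transport R (A - A1) (T - B) m n p2"
  shows "transport R A T m n (\<lambda>x y. p1 x y + p2 x y)"
proof -
  have z1: "p1 x y = 0" if "x \<notin> A1 \<or> y \<notin> B" for x y
    using p1 that unfolding transport_def by blast
  have z2: "p2 x y = 0" if "x \<in> A1 \<or> y \<in> B" for x y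
    using p2 that unfolding transport_def by blast
  have row: "(\<Sum>y\<in>T. p1 x y + p2 x y) = (\<Sum>y\<in>B. p1 x y) + (\<Sum>y\<in>T-B. p2 x y)" for x
  proof -
    have "(\<Sum>y\<in>T. p1 x y) = (\<Sum>y\<in>B. p1 x y)"
      by (rule sum.mono_neutral_right) (use fin sub z1 in auto)
    moreover have "(\<Sum>y\<in>T. p2 x y) = (\<Sum>y\<in>T-B. p2 x y)"
      by (rule sum.mono_neutral_right) (use fin sub z2 in auto)
    ultimately show ?thesis by (simp add: sum.distrib)
  qed
  have col: "(\<Sum>x\<in>A. p1 x y + p2 x y) = (\<Sum>x\<in>A1. p1 x y) + (\<Sum>x\<in>A-A1. p2 x y)" for y
  proof -
    have "(\<Sum>x\<in>A. p1 x y) = (\<Sum>x\<in>A1. p1 x y)"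
      by (rule sum.mono_neutral_right) (use fin sub z1 in auto)
    moreover have "(\<Sum>x\<in>A. p2 x y) = (\<Sum>x\<in>A-A1. p2 x y)"
      by (rule sum.mono_neutral_right) (use fin sub z2 in auto)
    ultimately show ?thesis by (simp add: sum.distrib)
  qed
  have "(\<Sum>y\<in>T. p1 x y + p2 x y) \<le> m x" if "x \<in> A" for x
  proof (cases "x \<in> A1")
    case True
    then have "(\<Sum>y\<in>T-B. p2 x y) = 0" using z2 by simp
    then show ?thesis using p1 True unfolding row transport_def by simp
  next
    case False
    then have "(\<Sum>y\<in>B. p1 x y) = 0" using z1 by simp
    then show ?thesis using p2 False that unfolding row transport_def by simp
  qed
  moreover have "(\<Sum>x\<in>A. p1 x y + p2 x y) = n y" if "y \<in> T" for y
  proof (cases "y \<in> B")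
    case True
    then have "(\<Sum>x\<in>A-A1. p2 x y) = 0" using z2 by simp
    then show ?thesis using p1 True unfolding col transport_def by simp
  next
    case False
    then have "(\<Sum>x\<in>A1. p1 x y) = 0" using z1 by simp
    then show ?thesis using p2 False that unfolding col transport_def by simp
  qed
  moreover have "x \<in> A \<and> y \<in> T \<and> R x y" if "p1 x y + p2 x y \<noteq> 0" for x y
  proof -
    have "p1 x y \<noteq> 0 \<or> p2 x y \<noteq> 0" using that by auto
    then show ?thesis using p1 p2 sub unfolding transport_def by blast
  qed
  moreover have "0 \<le> p1 x y + p2 x y" for x y
    using p1 p2 unfolding transport_def by simp
  ultimately show ?thesis unfolding transport_def by blast
qed

text \<open>Undoes a push of mass: a plan for the residual weights is completed by the amount
  already committed to the edge.\<close>

lemma transport_add_edge: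
  assumes fin: "finite A" "finite T" and xy: "x \<in> A" "y \<in> T" "R x y" and t: "0 \<le> t"
    and p: "transport R A T (m(x := m x - t)) (n(y := n y - t)) p"
  shows "transport R A T m n (\<lambda>u v. p u v + (if u = x \<and> v = y then t else 0))"
proof -
  have "(\<Sum>v\<in>T. p u v + (if u = x \<and> v = y then t else 0)) \<le> m u" if "u \<in> A" for u
  proof (cases "u = x")
    case True
    have "(\<Sum>v\<in>T. p x v) \<le> m x - t" using p xy unfolding transport_def by auto
    then show ?thesis using True fin xy by (simp add: sum.distrib)
  next
    case False
    then show ?thesis using p that unfolding transport_def by auto
  qed
  moreover have "(\<Sum>u\<in>A. p u v + (if u = x \<and> v = y then t else 0)) = n v" if "v \<in> T" for v
  proof (cases "v = y")
    case True
    have "(\<Sum>u\<in>A. p u y) = n y - t" using p xy unfolding transport_def by auto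
    then show ?thesis using True fin xy by (simp add: sum.distrib)
  next
    case False
    then show ?thesis using p that unfolding transport_def by auto
  qed
  ultimately show ?thesis using p t xy unfolding transport_def by (auto split: if_splits)
qed

text \<open>By tightness the sinks in \<open>B\<close> consume all the mass of their neighbours, so
  the other sinks must be served by the remaining sources. For \<open>C\<close> outside
  \<open>B\<close>, subtracting the equality for \<open>B\<close> from the Hall inequality for
  \<open>B \<union> C\<close> leaves exactly the inequality for \<open>C\<close> over those sources.
  For \<open>C\<close> inside \<open>B\<close> no neighbour is lost.\<close>

lemma hall_condition_split:
  assumes fin: "finite A" "finite T" and H: "hall_condition R A T m n" and B: "B \<subseteq> T"
    and tight: "sum n B = sum m (nbrs R A B)"
  shows "hall_condition R (nbrs R A B) B m n"
    and "hall_condition R (A - nbrs R A B) (T - B) m n"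
proof -
  have "nbrs R (nbrs R A B) C = nbrs R A C" if "C \<subseteq> B" for C
    using that by (auto simp: nbrs_def)
  then show "hall_condition R (nbrs R A B) B m n"
    using H B nbrs_subset[of R A B] unfolding hall_condition_def by (simp add: subset_iff)
  have "sum n C \<le> sum m (nbrs R (A - nbrs R A B) C)" if C: "C \<subseteq> T - B" for C
  proof -
    have "sum n B + sum n C = sum n (B \<union> C)"
      by (rule sum.union_disjoint[symmetric]) (use B C fin in \<open>auto intro: finite_subset\<close>)
    also have "\<dots> \<le> sum m (nbrs R A (B \<union> C))"
      using H B C unfolding hall_condition_def by (metis Diff_subset Un_least order_trans)
    also have "nbrs R A (B \<union> C) = nbrs R A B \<union> nbrs R (A - nbrs R A B) C"
      by (auto simp: nbrs_def)
    also have "sum m \<dots> = sum m (nbrs R A B) + sum m (nbrs R (A - nbrs R A B) C)"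
      by (rule sum.union_disjoint) (use fin in \<open>auto simp: nbrs_def\<close>)
    finally show ?thesis using tight by simp
  qed
  then show "hall_condition R (A - nbrs R A B) (T - B) m n"
    using H unfolding hall_condition_def by blast
qed

lemma hall_condition_drop_source:
  assumes "finite A" "x \<in> A" "m x = 0" "hall_condition R A T m n"
  shows "hall_condition R (A - {x}) T m n"
proof -
  have "sum m (nbrs R (A - {x}) B) = sum m (nbrs R A B)" for B
    by (rule sum.mono_neutral_left) (use assms in \<open>auto simp: nbrs_def\<close>)
  then show ?thesis using assms(4) unfolding hall_condition_def by auto
qed

text \<open>
  Mass is pushed along an edge until a source or a sink is exhausted or the Hall condition becomes
  tight for a nonempty proper subset of the sinks; in the last case the problem splits in two.
\<close>

theorem hall_real_weights:
  assumes "finite A" "finite T" "hall_condition R A T m n"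
  shows "\<exists>p. transport R A T m n p"
  using assms
proof (induction "card A + card T" arbitrary: A T m n rule: less_induct)
  case less
  note fin = less.prems(1,2)
  \<comment> \<open>The weights are generalized because this is applied below both to the given
    weights and to the residual ones, on the same \<open>A\<close> and \<open>T\<close>. The
    induction measure ignores weights.\<close>
  have reducible: "\<exists>p. transport R A T m n p"
    if H: "hall_condition R A T m n"
      and red: "(\<exists>y\<in>T. n y = 0) \<or> (\<exists>x\<in>A. m x = 0) \<or>
        (\<exists>B. B \<subseteq> T \<and> B \<noteq> {} \<and> B \<noteq> T \<and> sum n B = sum m (nbrs R A B))" for m n
    using red
  proof (elim disjE bexE exE conjE)
    fix y assume y: "y \<in> T" "n y = 0"
    have "card (T - {y}) < card T" by (rule card_Diff1_less[OF fin(2) y(1)])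
    moreover have "hall_condition R A (T - {y}) m n"
      using H unfolding hall_condition_def by blast
    ultimately obtain p where "transport R A (T - {y}) m n p"
      using less.hyps[of A "T - {y}" m n] fin by auto
    then show ?thesis using transport_drop_sink[of T y n] fin y by blast
  next
    fix x assume x: "x \<in> A" "m x = 0"
    have "card (A - {x}) < card A" by (rule card_Diff1_less[OF fin(1) x(1)])
    then obtain p where "transport R (A - {x}) T m n p"
      using less.hyps[of "A - {x}" T m n] fin hall_condition_drop_source[OF fin(1) x H] by auto
    then show ?thesis using transport_drop_source[of A x m] fin x by blast
  next
    fix B assume B: "B \<subseteq> T" "B \<noteq> {}" "B \<noteq> T" and tight: "sum n B = sum m (nbrs R A B)"
    let ?N = "nbrs R A B"
    have N: "?N \<subseteq> A" by (rule nbrs_subset)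
    have fB: "finite B" "finite ?N" using B N fin finite_subset by blast+
    \<comment> \<open>Both halves have strictly fewer sinks, as \<open>B\<close> is nonempty and
      proper; the source sides need only not grow.\<close>
    have "card B < card T" using B fin by (simp add: psubset_card_mono psubsetI)
    moreover have "card (T - B) < card T"
      using B fin by (intro psubset_card_mono) auto
    moreover have "card ?N \<le> card A" "card (A - ?N) \<le> card A"
      using fin N by (auto intro: card_mono)
    ultimately have c: "card ?N + card B < card A + card T"
      "card (A - ?N) + card (T - B) < card A + card T" by linarith+
    obtain p1 where p1: "transport R ?N B m n p1"
      using less.hyps[OF c(1) fB(2,1) hall_condition_split(1)[OF fin H B(1) tight]] by blast
    obtain p2 where p2: "transport R (A - ?N) (T - B) m n p2"
      using less.hyps[OF c(2) _ _ hall_condition_split(2)[OF fin H B(1) tight]] fin by blast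
    show ?thesis using transport_union[OF fin N B(1) p1 p2] by blast
  qed
  note H = less.prems(3)
  show ?case
  proof (cases "\<exists>y\<in>T. n y \<noteq> 0")
    case False
    show ?thesis
    proof (cases "T = {}")
      case True
      then have "transport R A T m n (\<lambda>x y. 0)"
        using H unfolding transport_def hall_condition_def by auto
      then show ?thesis by blast
    next
      case nonempty: False
      then show ?thesis using False reducible[OF H] by blast
    qed
  next
    case True
    then obtain y where y: "y \<in> T" "n y \<noteq> 0" by blast
    have "nbrs R A {y} \<noteq> {}"
    proof
      assume "nbrs R A {y} = {}"
      moreover have "sum n {y} \<le> sum m (nbrs R A {y})" "0 \<le> n y"
        using H y(1) unfolding hall_condition_def by blast+
      ultimately show False using y(2) by simp
    qed
    then obtain x where x: "x \<in> A" "R x y" by (auto simp: nbrs_def)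
    define slack where "slack B = sum m (nbrs R A B) - sum n B" for B
    \<comment> \<open>These are the sets whose slack a push along the edge from \<open>x\<close> to
      \<open>y\<close> reduces. If \<open>y \<in> B\<close>, then \<open>x\<close> is a neighbour
      and both sides drop equally; if \<open>x\<close> is no neighbour, neither side changes. A
      member of \<open>F\<close> is nonempty because it has a neighbour, and proper because it
      misses \<open>y\<close>.\<close>
    define F where "F = {B. B \<subseteq> T \<and> x \<in> nbrs R A B \<and> y \<notin> B}"
    \<comment> \<open>The largest push that keeps the weights nonnegative and the Hall condition
      valid. The minimum is attained, so afterwards one of the reducible cases holds.\<close>
    define t where "t = Min ({n y, m x} \<union> slack ` F)"
    have finF: "finite F" using fin unfolding F_def by simp
    have t_le: "t \<le> n y" "t \<le> m x" "\<And>B. B \<in> F \<Longrightarrow> t \<le> slack B"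
      unfolding t_def by (rule Min_le; use finF in auto)+
    have t_in: "t \<in> {n y, m x} \<union> slack ` F"
      unfolding t_def using finF by (intro Min_in) auto
    have t0: "0 \<le> t"
      using t_in H x y unfolding hall_condition_def slack_def F_def by auto
    define m' where "m' = m(x := m x - t)"
    define n' where "n' = n(y := n y - t)"
    have sm: "sum m' C = sum m C - (if x \<in> C then t else 0)" if "C \<subseteq> A" for C
    proof -
      have "sum m' C = (\<Sum>u\<in>C. m u - (if u = x then t else 0))"
        unfolding m'_def by (rule sum.cong) auto
      then show ?thesis using finite_subset[OF that fin(1)] by (simp add: sum_subtractf)
    qed
    have sn: "sum n' C = sum n C - (if y \<in> C then t else 0)" if "C \<subseteq> T" for C
    proof -
      have "sum n' C = (\<Sum>u\<in>C. n u - (if u = y then t else 0))"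
        unfolding n'_def by (rule sum.cong) auto
      then show ?thesis using finite_subset[OF that fin(2)] by (simp add: sum_subtractf)
    qed
    have "sum n' B \<le> sum m' (nbrs R A B)" if B: "B \<subseteq> T" for B
    proof -
      have le: "sum n B \<le> sum m (nbrs R A B)" using H B unfolding hall_condition_def by blast
      show ?thesis
      proof (cases "y \<in> B")
        case True
        then have "x \<in> nbrs R A B" using x by (auto simp: nbrs_def)
        then show ?thesis using True le by (simp add: sm sn B nbrs_subset)
      next
        case False
        then show ?thesis using le t_le(3)[of B] B
          by (auto simp: sm sn nbrs_subset F_def slack_def)
      qed
    qed
    then have H': "hall_condition R A T m' n'"
      using H t_le(1,2) unfolding hall_condition_def m'_def n'_def by auto
    have "(\<exists>y\<in>T. n' y = 0) \<or> (\<exists>x\<in>A. m' x = 0) \<or>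
        (\<exists>B. B \<subseteq> T \<and> B \<noteq> {} \<and> B \<noteq> T \<and> sum n' B = sum m' (nbrs R A B))"
    proof -
      consider "t = n y" | "t = m x" | B where "B \<in> F" "t = slack B" using t_in by blast
      then show ?thesis
      proof cases
        case 1
        then show ?thesis using y(1) by (auto simp: n'_def)
      next
        case 2
        then show ?thesis using x(1) by (auto simp: m'_def)
      next
        case 3
        then have B: "B \<subseteq> T" "x \<in> nbrs R A B" "y \<notin> B" by (auto simp: F_def)
        then have "sum n' B = sum m' (nbrs R A B)"
          using 3(2) by (simp add: sm sn nbrs_subset slack_def)
        moreover have "B \<noteq> {}" "B \<noteq> T" using B y(1) by (auto simp: nbrs_def)
        ultimately show ?thesis using B(1) by blast
      qed
    qed
    then obtain p where "transport R A T m' n' p" using reducible[OF H'] by blast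
    then show ?thesis
      using transport_add_edge[of A T x y R t m n] fin x y t0 unfolding m'_def n'_def by blast
  qed
qed

section \<open>Strassen's theorem for finitely supported distributions\<close>

lemma measure_pmf_eq_sum:
  assumes "finite A" "set_pmf \<mu> \<subseteq> A"
  shows "measure_pmf.prob \<mu> S = (\<Sum>x\<in>A \<inter> S. pmf \<mu> x)"
proof -
  have "measure_pmf.prob \<mu> S = measure_pmf.prob \<mu> (A \<inter> S)"
    by (rule measure_prob_cong_0) (use assms in \<open>auto simp: set_pmf_iff\<close>)
  then show ?thesis using assms by (simp add: measure_measure_pmf_finite)
qed

text \<open>The row sums add up to 1, so the matrix is a probability mass function; its support lies
  in a product of two finite sets.\<close>

lemma coupling_of_matrix:
  fixes p :: "'a \<Rightarrow> 'b \<Rightarrow> real"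
  assumes mu: "\<mu> \<in> fin_dists" and nu: "\<nu> \<in> fin_dists"
    and nonneg: "\<And>x y. 0 \<le> p x y"
    and supp: "\<And>x y. p x y \<noteq> 0 \<Longrightarrow> x \<in> set_pmf \<mu> \<and> y \<in> set_pmf \<nu>"
    and row: "\<And>x. x \<in> set_pmf \<mu> \<Longrightarrow> (\<Sum>y\<in>set_pmf \<nu>. p x y) = pmf \<mu> x"
    and col: "\<And>y. y \<in> set_pmf \<nu> \<Longrightarrow> (\<Sum>x\<in>set_pmf \<mu>. p x y) = pmf \<nu> y"
  shows "\<exists>\<rho>\<in>couplings \<mu> \<nu>. \<forall>x y. pmf \<rho> (x, y) = p x y"
proof -
  let ?A = "set_pmf \<mu>" and ?T = "set_pmf \<nu>"
  have fin: "finite ?A" "finite ?T" using mu nu by (auto simp: fin_dists_def)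
  have "(\<integral>\<^sup>+ z. ennreal (case_prod p z) \<partial>count_space UNIV) =
      (\<Sum>z\<in>?A \<times> ?T. ennreal (case_prod p z))"
    by (rule nn_integral_count_space') (use fin supp nonneg in \<open>auto simp: order_less_le\<close>)
  also have "\<dots> = ennreal (\<Sum>z\<in>?A \<times> ?T. case_prod p z)"
    by (rule sum_ennreal) (auto simp: nonneg)
  also have "(\<Sum>z\<in>?A \<times> ?T. case_prod p z) = (\<Sum>x\<in>?A. pmf \<mu> x)"
    using row by (simp add: sum.cartesian_product[symmetric])
  also have "\<dots> = 1" using fin by (simp add: sum_pmf_eq_1)
  finally have int: "(\<integral>\<^sup>+ z. ennreal (case_prod p z) \<partial>count_space UNIV) = 1" by simp
  define \<rho> where "\<rho> = embed_pmf (case_prod p)"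
  have pmf: "pmf \<rho> (x, y) = p x y" for x y
    unfolding \<rho>_def by (subst pmf_embed_pmf) (auto simp: nonneg int)
  have set: "set_pmf \<rho> \<subseteq> ?A \<times> ?T" using supp pmf by (auto simp: set_pmf_iff)
  have "pmf (map_pmf fst \<rho>) x = pmf \<mu> x" for x
  proof (cases "x \<in> ?A")
    case True
    have "pmf (map_pmf fst \<rho>) x = (\<Sum>z\<in>(?A \<times> ?T) \<inter> fst -` {x}. pmf \<rho> z)"
      unfolding pmf_map by (rule measure_pmf_eq_sum) (use fin set in auto)
    also have "(?A \<times> ?T) \<inter> fst -` {x} = {x} \<times> ?T" using True by auto
    also have "(\<Sum>z\<in>{x} \<times> ?T. pmf \<rho> z) = (\<Sum>y\<in>?T. pmf \<rho> (x, y))"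
      by (simp add: sum.cartesian_product')
    finally show ?thesis using row[OF True] by (simp add: pmf)
  next
    case False
    then have "x \<notin> set_pmf (map_pmf fst \<rho>)" using set by auto
    then show ?thesis using False unfolding set_pmf_iff by simp
  qed
  moreover have "pmf (map_pmf snd \<rho>) y = pmf \<nu> y" for y
  proof (cases "y \<in> ?T")
    case True
    have "pmf (map_pmf snd \<rho>) y = (\<Sum>z\<in>(?A \<times> ?T) \<inter> snd -` {y}. pmf \<rho> z)"
      unfolding pmf_map by (rule measure_pmf_eq_sum) (use fin set in auto)
    also have "(?A \<times> ?T) \<inter> snd -` {y} = ?A \<times> {y}" using True by auto
    also have "(\<Sum>z\<in>?A \<times> {y}. pmf \<rho> z) = (\<Sum>x\<in>?A. pmf \<rho> (x, y))"
      by (simp add: sum.cartesian_product')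
    finally show ?thesis using col[OF True] by (simp add: pmf)
  next
    case False
    then have "y \<notin> set_pmf (map_pmf snd \<rho>)" using set by auto
    then show ?thesis using False unfolding set_pmf_iff by simp
  qed
  moreover have "finite (set_pmf \<rho>)" using set fin finite_subset by blast
  ultimately have "\<rho> \<in> couplings \<mu> \<nu>"
    unfolding couplings_def fin_dists_def by (auto intro: pmf_eqI)
  then show ?thesis using pmf by blast
qed

text \<open>
  The residual marginals have equal total mass \<open>d\<close>, so their product divided by \<open>d\<close> fills them up.
  If \<open>d = 0\<close>, both residuals vanish and the convention \<open>x / 0 = 0\<close> gives the right answer.
\<close>

lemma subcoupling_extend:
  fixes s :: "'a \<Rightarrow> 'b \<Rightarrow> real"
  assumes mu: "\<mu> \<in> fin_dists" and nu: "\<nu> \<in> fin_dists"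
    and nonneg: "\<And>x y. 0 \<le> s x y"
    and supp: "\<And>x y. s x y \<noteq> 0 \<Longrightarrow> x \<in> set_pmf \<mu> \<and> y \<in> set_pmf \<nu>"
    and row: "\<And>x. x \<in> set_pmf \<mu> \<Longrightarrow> (\<Sum>y\<in>set_pmf \<nu>. s x y) \<le> pmf \<mu> x"
    and col: "\<And>y. y \<in> set_pmf \<nu> \<Longrightarrow> (\<Sum>x\<in>set_pmf \<mu>. s x y) \<le> pmf \<nu> y"
  shows "\<exists>\<rho>\<in>couplings \<mu> \<nu>. \<forall>x y. s x y \<le> pmf \<rho> (x, y)"
proof -
  let ?A = "set_pmf \<mu>" and ?T = "set_pmf \<nu>"
  have fin: "finite ?A" "finite ?T" using mu nu by (auto simp: fin_dists_def)
  define a where "a x = (if x \<in> ?A then pmf \<mu> x - (\<Sum>y\<in>?T. s x y) else 0)" for x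
  define b where "b y = (if y \<in> ?T then pmf \<nu> y - (\<Sum>x\<in>?A. s x y) else 0)" for y
  define d where "d = sum a ?A"
  have a0: "0 \<le> a x" for x using row by (simp add: a_def)
  have b0: "0 \<le> b y" for y using col by (simp add: b_def)
  have d: "d = 1 - (\<Sum>x\<in>?A. \<Sum>y\<in>?T. s x y)"
    unfolding d_def a_def using fin by (simp add: sum_subtractf sum_pmf_eq_1)
  have d': "sum b ?T = d"
    unfolding d b_def using fin
    by (simp add: sum_subtractf sum_pmf_eq_1 sum.swap[of _ ?T ?A])
  have d0: "0 \<le> d" unfolding d_def by (simp add: a0 sum_nonneg)
  have ad: "a x * d / d = a x" if "x \<in> ?A" for x
    using that fin a0 sum_nonneg_eq_0_iff[of ?A a] by (cases "d = 0") (auto simp: d_def)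
  have bd: "d * b y / d = b y" if "y \<in> ?T" for y
    using that fin b0 sum_nonneg_eq_0_iff[of ?T b] d' by (cases "d = 0") auto
  define p where "p x y = s x y + a x * b y / d" for x y
  have "\<exists>\<rho>\<in>couplings \<mu> \<nu>. \<forall>x y. pmf \<rho> (x, y) = p x y"
  proof (rule coupling_of_matrix[OF mu nu])
    show "0 \<le> p x y" for x y using nonneg a0 b0 d0 by (simp add: p_def)
    show "x \<in> ?A \<and> y \<in> ?T" if "p x y \<noteq> 0" for x y
    proof -
      have "s x y \<noteq> 0 \<or> (a x \<noteq> 0 \<and> b y \<noteq> 0)" using that unfolding p_def by auto
      then show ?thesis using supp unfolding a_def b_def by (metis (full_types))
    qed
    show "(\<Sum>y\<in>?T. p x y) = pmf \<mu> x" if "x \<in> ?A" for x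
    proof -
      have "(\<Sum>y\<in>?T. p x y) = (\<Sum>y\<in>?T. s x y) + a x * sum b ?T / d"
        unfolding p_def by (simp add: sum.distrib sum_distrib_left sum_divide_distrib)
      then show ?thesis using ad[OF that] that d' by (simp add: a_def)
    qed
    show "(\<Sum>x\<in>?A. p x y) = pmf \<nu> y" if "y \<in> ?T" for y
    proof -
      have "(\<Sum>x\<in>?A. p x y) = (\<Sum>x\<in>?A. s x y) + sum a ?A * b y / d"
        unfolding p_def by (simp add: sum.distrib sum_distrib_right sum_divide_distrib)
      then show ?thesis using bd[OF that] that by (simp add: b_def d_def)
    qed
  qed
  moreover have "s x y \<le> p x y" for x y using a0 b0 d0 by (simp add: p_def)
  ultimately show ?thesis by metis
qed

text \<open>
  The deficiency \<open>\<epsilon>\<close> is absorbed by an additional source \<open>None\<close> of mass \<open>\<epsilon>\<close> that is related to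
  every sink.
\<close>

theorem strassen_finite:
  fixes R :: "'a \<Rightarrow> 'b \<Rightarrow> bool"
  assumes mu: "\<mu> \<in> fin_dists" and nu: "\<nu> \<in> fin_dists" and eps: "0 \<le> \<epsilon>"
    and hall: "\<And>B. measure_pmf.prob \<nu> B \<le> measure_pmf.prob \<mu> {x. \<exists>y\<in>B. R x y} + \<epsilon>"
  shows "\<exists>\<rho>\<in>couplings \<mu> \<nu>. measure_pmf.prob \<rho> {(x, y). \<not> R x y} \<le> \<epsilon>"
proof -
  let ?A = "set_pmf \<mu>" and ?T = "set_pmf \<nu>"
  have fin: "finite ?A" "finite ?T" using mu nu by (auto simp: fin_dists_def)
  define A' where "A' = insert None (Some ` ?A)"
  define m where "m u = (case u of None \<Rightarrow> \<epsilon> | Some x \<Rightarrow> pmf \<mu> x)" for u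
  define R' where "R' u y = (case u of None \<Rightarrow> True | Some x \<Rightarrow> R x y)" for u y
  have sumA': "(\<Sum>u\<in>A'. h u) = h None + (\<Sum>x\<in>?A. h (Some x))" for h :: "'a option \<Rightarrow> real"
    unfolding A'_def using fin by (simp add: sum.reindex)
  \<comment> \<open>Every nonempty \<open>B\<close> has \<open>None\<close> as a neighbour, which
    contributes the \<open>\<epsilon>\<close> of the hypothesis. The empty set has no neighbours and
    no demand.\<close>
  have "sum (pmf \<nu>) B \<le> sum m (nbrs R' A' B)" if B: "B \<subseteq> ?T" for B
  proof (cases "B = {}")
    case True
    then show ?thesis by (simp add: nbrs_def)
  next
    case False
    let ?N = "{x. \<exists>y\<in>B. R x y}"
    have "nbrs R' A' B = insert None (Some ` (?A \<inter> ?N))"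
      using False by (auto simp: nbrs_def A'_def R'_def intro!: imageI)
    then have "sum m (nbrs R' A' B) = \<epsilon> + (\<Sum>x\<in>?A \<inter> ?N. pmf \<mu> x)"
      using fin by (simp add: sum.reindex m_def)
    moreover have "sum (pmf \<nu>) B = measure_pmf.prob \<nu> B"
      using B fin by (simp add: finite_subset measure_measure_pmf_finite)
    ultimately show ?thesis
      using hall[of B] fin by (simp add: measure_pmf_eq_sum[of ?A \<mu>])
  qed
  then have "hall_condition R' A' ?T m (pmf \<nu>)"
    using eps by (auto simp: hall_condition_def m_def split: option.split)
  moreover have "finite A'" using fin by (simp add: A'_def)
  ultimately obtain q where q: "transport R' A' ?T m (pmf \<nu>) q"
    using hall_real_weights fin by blast
  define s where "s x y = q (Some x) y" for x y
  have q0: "0 \<le> q u y" for u y using q by (simp add: transport_def)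
  have supp: "x \<in> ?A \<and> y \<in> ?T \<and> R x y" if "s x y \<noteq> 0" for x y
  proof -
    have "Some x \<in> A' \<and> y \<in> ?T \<and> R' (Some x) y"
      using q that unfolding transport_def s_def by blast
    then show ?thesis by (auto simp: A'_def R'_def)
  qed
  have colq: "q None y + (\<Sum>x\<in>?A. s x y) = pmf \<nu> y" if "y \<in> ?T" for y
    using q that unfolding transport_def sumA' s_def by blast
  have "\<exists>\<rho>\<in>couplings \<mu> \<nu>. \<forall>x y. s x y \<le> pmf \<rho> (x, y)"
  proof (rule subcoupling_extend[OF mu nu])
    show "0 \<le> s x y" for x y by (simp add: s_def q0)
    show "x \<in> ?A \<and> y \<in> ?T" if "s x y \<noteq> 0" for x y using supp[OF that] by blast
    show "(\<Sum>y\<in>?T. s x y) \<le> pmf \<mu> x" if "x \<in> ?A" for x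
    proof -
      have "(\<Sum>y\<in>?T. q (Some x) y) \<le> m (Some x)"
        using q that unfolding transport_def A'_def by blast
      then show ?thesis by (simp add: s_def m_def)
    qed
    show "(\<Sum>x\<in>?A. s x y) \<le> pmf \<nu> y" if "y \<in> ?T" for y
      using colq[OF that] q0[of None y] by linarith
  qed
  then obtain \<rho> where rho: "\<rho> \<in> couplings \<mu> \<nu>" and s_le: "\<And>x y. s x y \<le> pmf \<rho> (x, y)"
    by blast
  have "map_pmf fst \<rho> = \<mu>" "map_pmf snd \<rho> = \<nu>" using rho by (auto simp: couplings_def)
  then have set: "set_pmf \<rho> \<subseteq> ?A \<times> ?T" by (auto simp flip: set_map_pmf simp: image_iff) force+
  \<comment> \<open>The total demand 1 splits into the share of \<open>None\<close>, at most
    \<open>\<epsilon>\<close>, and the mass of \<open>s\<close>, which lies on \<open>R\<close> and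
    is dominated by \<open>\<rho>\<close>. Hence \<open>\<rho>\<close> gives \<open>R\<close> at
    least \<open>1 - \<epsilon>\<close>.\<close>
  have "1 = (\<Sum>y\<in>?T. pmf \<nu> y)" using fin by (simp add: sum_pmf_eq_1)
  also have "\<dots> = (\<Sum>y\<in>?T. q None y + (\<Sum>x\<in>?A. s x y))" using colq by simp
  also have "\<dots> = (\<Sum>y\<in>?T. q None y) + (\<Sum>x\<in>?A. \<Sum>y\<in>?T. s x y)"
    by (simp add: sum.distrib sum.swap[of _ ?T ?A])
  also have "(\<Sum>y\<in>?T. q None y) \<le> \<epsilon>"
    using q by (simp add: transport_def A'_def m_def)
  also have "(\<Sum>x\<in>?A. \<Sum>y\<in>?T. s x y) = (\<Sum>z\<in>?A \<times> ?T. case_prod s z)"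
    by (simp add: sum.cartesian_product)
  also have "\<dots> = (\<Sum>z\<in>(?A \<times> ?T) \<inter> {(x, y). R x y}. case_prod s z)"
    by (rule sum.mono_neutral_right) (use fin supp in auto)
  also have "\<dots> \<le> (\<Sum>z\<in>(?A \<times> ?T) \<inter> {(x, y). R x y}. pmf \<rho> z)"
    by (rule sum_mono) (auto simp: s_le)
  also have "\<dots> = measure_pmf.prob \<rho> {(x, y). R x y}"
    by (rule measure_pmf_eq_sum[symmetric]) (use fin set in auto)
  also have "\<dots> = 1 - measure_pmf.prob \<rho> (- {(x, y). R x y})"
    using measure_pmf.prob_compl[of "{(x, y). R x y}" \<rho>] by (simp add: Compl_eq_Diff_UNIV)
  also have "- {(x, y). R x y} = {(x, y). \<not> R x y}" by auto
  finally show ?thesis using rho by auto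
qed

section \<open>Kantorovich and Wasserstein liftings\<close>

lemma generally_leI:
  assumes "0 \<le> \<epsilon>" "measure_pmf.prob \<mu> {z. f z > \<epsilon>} \<le> \<epsilon>"
  shows "generally f \<mu> \<le> \<epsilon>"
  unfolding generally_def by (rule cInf_lower) (use assms in auto)

lemma generally_geI:
  assumes "\<And>t. 0 \<le> t \<Longrightarrow> t < c \<Longrightarrow> t < measure_pmf.prob \<mu> {z. f z > t}"
  shows "c \<le> generally f \<mu>"
  unfolding generally_def
proof (rule cInf_greatest)
  \<comment> \<open>The threshold 1 is always admissible, since probabilities are at most 1.\<close>
  show "{\<epsilon>. 0 \<le> \<epsilon> \<and> measure_pmf.prob \<mu> {z. f z > \<epsilon>} \<le> \<epsilon>} \<noteq> {}"
    using measure_pmf.prob_le_1[of \<mu> "{z. f z > 1}"] zero_le_one by blast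
qed (use assms in force)

lemma generally_nonneg: "0 \<le> generally f \<mu>"
  by (rule generally_geI) simp

text \<open>Admissible thresholds are upward closed, because raising the threshold shrinks the
  superlevel set. The strict hypothesis avoids the question whether the infimum is attained.\<close>

lemma prob_le_of_generally_less:
  assumes "generally f \<mu> < \<epsilon>"
  shows "measure_pmf.prob \<mu> {z. f z > \<epsilon>} \<le> \<epsilon>"
proof (rule ccontr)
  assume *: "\<not> ?thesis"
  have "\<epsilon> \<le> generally f \<mu>"
  proof (rule generally_geI)
    fix t assume "t < \<epsilon>"
    then have "{z. f z > \<epsilon>} \<subseteq> {z. f z > t}" by auto
    then have "measure_pmf.prob \<mu> {z. f z > \<epsilon>} \<le> measure_pmf.prob \<mu> {z. f z > t}"
      by (intro measure_pmf.finite_measure_mono) auto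
    then show "t < measure_pmf.prob \<mu> {z. f z > t}" using * \<open>t < \<epsilon>\<close> by linarith
  qed
  then show False using assms by simp
qed

lemma generally_le_add:
  fixes r :: "'a \<times> 'b \<Rightarrow> real"
  assumes "\<rho> \<in> couplings \<mu> \<nu>" "nonexpansive_pair r f g"
  shows "generally g \<nu> \<le> generally f \<mu> + generally r \<rho>"
proof (rule field_le_epsilon)
  fix e :: real assume e: "0 < e"
  \<comment> \<open>The margins of \<open>e / 2\<close> put \<open>a\<close> and \<open>b\<close>
    strictly above the two infima, so both are admissible thresholds.\<close>
  define a where "a = generally f \<mu> + e / 2"
  define b where "b = generally r \<rho> + e / 2"
  have mu: "\<mu> = map_pmf fst \<rho>" and nu: "\<nu> = map_pmf snd \<rho>"
    using assms(1) by (auto simp: couplings_def)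
  have le: "g y \<le> f x + r (x, y)" for x y
    using assms(2) by (simp add: nonexpansive_pair_def algebra_simps)
  have "snd -` {y. g y > a + b} \<subseteq> fst -` {x. f x > a} \<union> {z. r z > b}"
  proof
    fix z :: "'a \<times> 'b" assume "z \<in> snd -` {y. g y > a + b}"
    then show "z \<in> fst -` {x. f x > a} \<union> {z. r z > b}"
      using le[of "snd z" "fst z"] by auto
  qed
  then have "measure_pmf.prob \<nu> {y. g y > a + b} \<le>
      measure_pmf.prob \<rho> (fst -` {x. f x > a} \<union> {z. r z > b})"
    unfolding nu measure_map_pmf by (intro measure_pmf.finite_measure_mono) auto
  also have "\<dots> \<le> measure_pmf.prob \<mu> {x. f x > a} + measure_pmf.prob \<rho> {z. r z > b}"
    unfolding mu measure_map_pmf by (intro measure_Un_le) auto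
  also have "\<dots> \<le> a + b"
    using e by (intro add_mono prob_le_of_generally_less) (auto simp: a_def b_def)
  finally have "generally g \<nu> \<le> a + b"
    using e generally_nonneg[of f \<mu>] generally_nonneg[of r \<rho>]
    by (intro generally_leI) (auto simp: a_def b_def)
  then show "generally g \<nu> \<le> generally f \<mu> + generally r \<rho> + e"
    by (simp add: a_def b_def)
qed

section \<open>Bounds for the two liftings\<close>

lemma trunc_diff_generally_le:
  assumes "\<rho> \<in> couplings \<mu> \<nu>" "nonexpansive_pair r f g"
  shows "generally g \<nu> \<ominus> generally f \<mu> \<le> generally r \<rho>"
  using generally_le_add[OF assms] generally_nonneg[of r \<rho>] by (simp add: trunc_diff_def)

text \<open>The independent coupling makes the infimum range over a nonempty set and bounds the
  supremum from above.\<close>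

lemma pair_pmf_in_couplings:
  assumes "\<mu> \<in> fin_dists" "\<nu> \<in> fin_dists"
  shows "pair_pmf \<mu> \<nu> \<in> couplings \<mu> \<nu>"
  using assms by (simp add: couplings_def fin_dists_def map_fst_pair_pmf map_snd_pair_pmf)

lemma wasserstein_le:
  assumes "\<rho> \<in> couplings \<mu> \<nu>"
  shows "wasserstein r \<mu> \<nu> \<le> generally r \<rho>"
  unfolding wasserstein_def
  by (rule cInf_lower) (use assms in \<open>auto intro!: bdd_belowI[of _ 0] simp: generally_nonneg\<close>)

lemma le_kantorovich:
  assumes "\<mu> \<in> fin_dists" "\<nu> \<in> fin_dists" "nonexpansive_pair r f g"
  shows "generally g \<nu> \<ominus> generally f \<mu> \<le> kantorovich r \<mu> \<nu>"
  unfolding kantorovich_def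
  by (rule cSup_upper)
    (use assms trunc_diff_generally_le[OF pair_pmf_in_couplings[OF assms(1,2)]]
     in \<open>auto intro!: bdd_aboveI\<close>)

text \<open>Makes the set under the supremum nonempty and shows that the Kantorovich value is
  nonnegative.\<close>

lemma nonexpansive_pair_zero:
  assumes "range r \<subseteq> {0..1}"
  shows "nonexpansive_pair r (\<lambda>_. 0) (\<lambda>_. 0)"
  using assms by (auto simp: nonexpansive_pair_def image_subset_iff)

lemma kantorovich_ge_of_hall_violation:
  assumes r: "range r \<subseteq> {0..1}" and mu: "\<mu> \<in> fin_dists" and nu: "\<nu> \<in> fin_dists"
    and eps: "0 \<le> \<epsilon>"
    and B: "measure_pmf.prob \<mu> {x. \<exists>y\<in>B. r (x, y) \<le> \<epsilon>} + \<epsilon> < measure_pmf.prob \<nu> B"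
  shows "\<epsilon> \<le> kantorovich r \<mu> \<nu>"
proof -
  define N where "N = {x. \<exists>y\<in>B. r (x, y) \<le> \<epsilon>}"
  define \<delta> where "\<delta> = measure_pmf.prob \<mu> N"
  \<comment> \<open>The levels are chosen to match masses: \<open>f\<close> exceeds
    \<open>\<delta>\<close> only on \<open>N\<close>, which has mass \<open>\<delta>\<close>, while
    every superlevel set of \<open>g\<close> below \<open>\<delta> + \<epsilon>\<close> is
    \<open>B\<close>, whose mass exceeds \<open>\<delta> + \<epsilon>\<close>. The difference
    \<open>g y - f x\<close> is positive only for \<open>y \<in> B\<close> and
    \<open>x \<notin> N\<close>, where it is at most \<open>\<epsilon>\<close> and
    \<open>r (x, y)\<close> is larger than \<open>\<epsilon>\<close>. The violation also forces
    \<open>\<delta> + \<epsilon>\<close> below 1, so both functions stay in the unit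
    interval.\<close>
  define f where "f x = (if x \<in> N then \<delta> + \<epsilon> else \<delta>)" for x
  define g where "g y = (if y \<in> B then \<delta> + \<epsilon> else 0)" for y
  have \<delta>0: "0 \<le> \<delta>" by (simp add: \<delta>_def)
  have less: "\<delta> + \<epsilon> < measure_pmf.prob \<nu> B" using B by (simp add: \<delta>_def N_def)
  then have le1: "\<delta> + \<epsilon> \<le> 1" using measure_pmf.prob_le_1[of \<nu> B] by linarith
  have r0: "0 \<le> r z" for z using r by (cases z) (auto simp: image_subset_iff)
  have "g y - f x \<le> r (x, y)" for x y
  proof (cases "y \<in> B \<and> x \<notin> N")
    case True
    then have "\<epsilon> < r (x, y)" by (auto simp: N_def not_le)
    then show ?thesis using True by (simp add: f_def g_def)
  next
    case False
    then show ?thesis using r0[of "(x, y)"] \<delta>0 eps by (auto simp: f_def g_def)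
  qed
  then have ne: "nonexpansive_pair r f g"
    using \<delta>0 eps le1 by (auto simp: nonexpansive_pair_def f_def g_def)
  have "generally f \<mu> \<le> \<delta>"
  proof (rule generally_leI[OF \<delta>0])
    show "measure_pmf.prob \<mu> {x. f x > \<delta>} \<le> \<delta>"
      unfolding \<delta>_def by (rule measure_pmf.finite_measure_mono) (auto simp: f_def \<delta>_def)
  qed
  moreover have "\<delta> + \<epsilon> \<le> generally g \<nu>"
  proof (rule generally_geI)
    fix t assume t: "0 \<le> t" "t < \<delta> + \<epsilon>"
    then have "{y. g y > t} = B" by (auto simp: g_def)
    then show "t < measure_pmf.prob \<nu> {y. g y > t}" using t less by simp
  qed
  ultimately have "\<epsilon> \<le> generally g \<nu> \<ominus> generally f \<mu>" by (simp add: trunc_diff_def)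
  also have "\<dots> \<le> kantorovich r \<mu> \<nu>" by (rule le_kantorovich[OF mu nu ne])
  finally show ?thesis .
qed

theorem theorem1:
  fixes r :: "'a \<times> 'b \<Rightarrow> real" and \<mu> :: "'a pmf" and \<nu> :: "'b pmf"
  assumes "range r \<subseteq> {0..1}"
    and "\<mu> \<in> fin_dists" and "\<nu> \<in> fin_dists"
  shows "kantorovich r \<mu> \<nu> = wasserstein r \<mu> \<nu>"
proof (rule antisym)
  show "kantorovich r \<mu> \<nu> \<le> wasserstein r \<mu> \<nu>"
    unfolding kantorovich_def
  proof (rule cSup_least)
    show "{generally g \<nu> \<ominus> generally f \<mu> | f g. nonexpansive_pair r f g} \<noteq> {}"
      using nonexpansive_pair_zero[OF assms(1)] by blast
    fix c assume "c \<in> {generally g \<nu> \<ominus> generally f \<mu> | f g. nonexpansive_pair r f g}"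
    then show "c \<le> wasserstein r \<mu> \<nu>"
      unfolding wasserstein_def
      using pair_pmf_in_couplings[OF assms(2,3)] trunc_diff_generally_le
      by (intro cInf_greatest) blast+
  qed
  show "wasserstein r \<mu> \<nu> \<le> kantorovich r \<mu> \<nu>"
  proof (rule ccontr)
    assume "\<not> ?thesis"
    \<comment> \<open>Strictness on the left rules out a Hall violation at
      \<open>\<epsilon>\<close>; strictness on the right contradicts the coupling that Strassen's
      theorem then provides.\<close>
    then obtain \<epsilon> where \<epsilon>: "kantorovich r \<mu> \<nu> < \<epsilon>" "\<epsilon> < wasserstein r \<mu> \<nu>"
      using dense not_le by blast
    have "0 \<le> kantorovich r \<mu> \<nu>"
      using le_kantorovich[OF assms(2,3) nonexpansive_pair_zero[OF assms(1)]]
      by (simp add: trunc_diff_def)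
    then have eps: "0 \<le> \<epsilon>" using \<epsilon>(1) by simp
    have "measure_pmf.prob \<nu> B \<le> measure_pmf.prob \<mu> {x. \<exists>y\<in>B. r (x, y) \<le> \<epsilon>} + \<epsilon>" for B
      using kantorovich_ge_of_hall_violation[OF assms eps, of B] \<epsilon>(1) by (meson not_le)
    then obtain \<rho> where \<rho>: "\<rho> \<in> couplings \<mu> \<nu>"
      and "measure_pmf.prob \<rho> {(x, y). \<not> r (x, y) \<le> \<epsilon>} \<le> \<epsilon>"
      using strassen_finite[OF assms(2,3) eps, of "\<lambda>x y. r (x, y) \<le> \<epsilon>"] by blast
    moreover have "{(x, y). \<not> r (x, y) \<le> \<epsilon>} = {z. r z > \<epsilon>}" by auto
    ultimately have "generally r \<rho> \<le> \<epsilon>" using generally_leI[OF eps] by simp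
    then show False using wasserstein_le[OF \<rho>, of r] \<epsilon>(2) by simp
  qed
qed

end
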